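(* Let $f \in \mathbb{Q}[x_1,\ldots,x_n]$. If there is an invertible Gram matrix $B$ for $f$, then there is a Gram matrix for $f$ with rational entries.
   Context: A Gram matrix for a polynomial $f$ is a real (symmetric) positive semidefinite square matrix $B$ such that $f = \mathbf{v}^T B \mathbf{v}$ for some column vector $\mathbf{v}$ of monomials in $x_1,\ldots,x_n$. *)

theory Defs
  imports Complex_Main "HOL-Library.Poly_Mapping" "Jordan_Normal_Form.Matrix"
begin

text \<open>
  Exponent vectors are finitely supported functions from variable indices to \<^typ>\<open>nat\<close>, and
  polynomials are finitely supported functions from exponent vectors to coefficients, with the
  convolution product of \<^theory>\<open>HOL-Library.Poly_Mapping\<close>.
  The variables x_1, ..., x_n are the indices 1, ..., n.
\<close>

type_synonym 'a mpoly = "(nat \<Rightarrow>\<^sub>0 nat) \<Rightarrow>\<^sub>0 'a"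

text \<open>K[x_1, ..., x_n] as a subset of the ambient polynomial ring; K is a set of coefficients.\<close>

definition mpolys :: "'a::zero set \<Rightarrow> nat \<Rightarrow> 'a mpoly set" where
  "mpolys K n = {f. (\<forall>m\<in>Poly_Mapping.keys f.
     Poly_Mapping.keys m \<subseteq> {1..n} \<and> Poly_Mapping.lookup f m \<in> K)}"

abbreviation mconst :: "'a::zero \<Rightarrow> 'a mpoly" where
  "mconst c \<equiv> Poly_Mapping.single 0 c"

text \<open>Monomials are power products (coefficient 1); the constant 1 is one of them.\<close>

definition monomials :: "nat \<Rightarrow> 'a::zero_neq_one mpoly set" where
  "monomials n = {Poly_Mapping.single m 1 | m. Poly_Mapping.keys m \<subseteq> {1..n}}"

definition psd_mat :: "real mat \<Rightarrow> bool" where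
  "psd_mat B \<longleftrightarrow> square_mat B \<and> transpose_mat B = B \<and>
     (\<forall>x\<in>carrier_vec (dim_row B). 0 \<le> x \<bullet> (B *\<^sub>v x))"

text \<open>The size of the Gram matrix and the vector of monomials are both unconstrained, and
  the entries of the vector need not be distinct.\<close>

definition gram_matrix :: "nat \<Rightarrow> real mpoly \<Rightarrow> real mat \<Rightarrow> bool" where
  "gram_matrix n f B \<longleftrightarrow> psd_mat B \<and>
     (\<exists>v\<in>carrier_vec (dim_row B). set\<^sub>v v \<subseteq> monomials n \<and>
        f = v \<bullet> (map_mat mconst B *\<^sub>v v))"

end

theory Submission
  imports Defs
begin

text \<open>
  For a fixed vector of monomials with exponents m_i, being a Gram matrix of f is the linear system
  "for every exponent a, the entries B_ij with m_i + m_j = a sum to the coefficient f_a".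
  Each entry occurs in exactly one of these equations, so one can round the entries of B to rationals
  and then distribute the rational error of each equation evenly over its entries; this keeps
  the matrix symmetric and moves each entry only slightly. An invertible positive semidefinite
  matrix is positive definite, hence stays positive semidefinite under small perturbations.
\<close>

section \<open>Quadratic forms and stability of positive semidefiniteness\<close>

lemma scalar_prod_mult_mat_vec:
  fixes A :: "'a::comm_semiring_0 mat"
  assumes "A \<in> carrier_mat n m" "x \<in> carrier_vec n" "y \<in> carrier_vec m"
  shows "x \<bullet> (A *\<^sub>v y) = (\<Sum>i<n. \<Sum>j<m. A $$ (i,j) * (x $ i * y $ j))"
proof -
  have "x \<bullet> (A *\<^sub>v y) = (\<Sum>i<n. x $ i * (\<Sum>j<m. A $$ (i,j) * y $ j))"
    using assms by (auto simp: scalar_prod_def lessThan_atLeast0 intro!: sum.cong)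
  then show ?thesis
    by (simp add: sum_distrib_left ac_simps)
qed

text \<open>By the AM-GM inequality every \<open>\<bar>x $ i * x $ j\<bar>\<close> is at most
  \<open>x \<bullet> x\<close>. The sum of the absolute entries thus serves as a crude operator
  norm, applied below to the inverse of a Gram matrix and to a perturbation.\<close>

lemma abs_quadratic_form_le:
  fixes A :: "real mat"
  assumes A: "A \<in> carrier_mat n n" and x: "x \<in> carrier_vec n"
  shows "\<bar>x \<bullet> (A *\<^sub>v x)\<bar> \<le> (\<Sum>i<n. \<Sum>j<n. \<bar>A $$ (i,j)\<bar>) * (x \<bullet> x)"
proof -
  have coord: "(x $ i)\<^sup>2 \<le> x \<bullet> x" if "i < n" for i
  proof -
    have "(x $ i)\<^sup>2 \<le> (\<Sum>i<n. (x $ i)\<^sup>2)"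
      using that by (intro member_le_sum) auto
    then show ?thesis
      using x by (simp add: scalar_prod_def lessThan_atLeast0 power2_eq_square)
  qed
  have prod_le: "\<bar>x $ i * x $ j\<bar> \<le> x \<bullet> x" if "i < n" "j < n" for i j
  proof -
    have "2 * (\<bar>x $ i\<bar> * \<bar>x $ j\<bar>) \<le> (x $ i)\<^sup>2 + (x $ j)\<^sup>2"
      using sum_squares_bound[of "\<bar>x $ i\<bar>" "\<bar>x $ j\<bar>"] by simp
    then show ?thesis
      using coord[OF that(1)] coord[OF that(2)] unfolding abs_mult by linarith
  qed
  have "\<bar>x \<bullet> (A *\<^sub>v x)\<bar> \<le> (\<Sum>i<n. \<Sum>j<n. \<bar>A $$ (i,j) * (x $ i * x $ j)\<bar>)"
    unfolding scalar_prod_mult_mat_vec[OF A x x]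
    by (rule order_trans[OF sum_abs sum_mono[OF sum_abs]])
  also have "\<dots> \<le> (\<Sum>i<n. \<Sum>j<n. \<bar>A $$ (i,j)\<bar> * (x \<bullet> x))"
    by (intro sum_mono) (auto simp: abs_mult[of "A $$ _"] intro!: mult_left_mono prod_le)
  finally show ?thesis
    by (simp add: sum_distrib_right)
qed

lemma scalar_prod_self_nonneg: "0 \<le> (x :: real vec) \<bullet> x"
  by (simp add: scalar_prod_def sum_nonneg)

text \<open>The argument behind Cauchy-Schwarz for the form of \<open>B\<close>, applied to
  \<open>x\<close> and \<open>C x\<close> with \<open>C\<close> the inverse of \<open>B\<close>,
  bounds \<open>x \<bullet> x\<close> by a multiple of the form. No eigenvalues are
  involved.\<close>

lemma psd_invertible_imp_coercive:
  assumes psd: "psd_mat B" and inv: "invertible_mat B"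
  shows "\<exists>c>0. \<forall>x\<in>carrier_vec (dim_row B). c * (x \<bullet> x) \<le> x \<bullet> (B *\<^sub>v x)"
proof -
  define n where "n = dim_row B"
  have B: "B \<in> carrier_mat n n" and sym: "transpose_mat B = B"
    and nonneg: "\<And>x. x \<in> carrier_vec n \<Longrightarrow> 0 \<le> x \<bullet> (B *\<^sub>v x)"
    using psd by (auto simp: psd_mat_def n_def)
  obtain C where BC: "B * C = 1\<^sub>m n" and CB: "C * B = 1\<^sub>m (dim_row C)"
    using inv by (auto simp: invertible_mat_def inverts_mat_def n_def)
  \<comment> \<open>The two inverse identities do not state the shape of \<open>C\<close>; comparing
    their column counts yields it.\<close>
  have C: "C \<in> carrier_mat n n"
    using arg_cong[OF BC, of dim_col] arg_cong[OF CB, of dim_col] B by auto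
  \<comment> \<open>The summand 1 keeps \<open>K\<close> positive even for
    \<open>n = 0\<close>.\<close>
  define K where "K = (\<Sum>i<n. \<Sum>j<n. \<bar>C $$ (i,j)\<bar>) + 1"
  have K: "K > 0"
    unfolding K_def by (intro add_nonneg_pos sum_nonneg) auto
  have "1 / K * (x \<bullet> x) \<le> x \<bullet> (B *\<^sub>v x)" if x: "x \<in> carrier_vec n" for x
  proof -
    \<comment> \<open>Expand \<open>0 \<le> z\<^sup>T B z\<close> for \<open>z = x - t C x\<close>; the choice \<open>t = 1 / K\<close> is optimal.\<close>
    define t where "t = 1 / K"
    define y where "y = C *\<^sub>v x"
    have y: "y \<in> carrier_vec n" and Bx: "B *\<^sub>v x \<in> carrier_vec n"
      using B C x by (auto simp: y_def)
    have By: "B *\<^sub>v y = x"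
      using assoc_mult_mat_vec[OF B C x] BC x by (simp add: y_def)
    have "y \<bullet> (B *\<^sub>v x) = (B *\<^sub>v y) \<bullet> x"
      using transpose_vec_mult_scalar[OF B x y] sym by simp
    then have yBx: "y \<bullet> (B *\<^sub>v x) = x \<bullet> x"
      by (simp add: By)
    have yx: "y \<bullet> x = x \<bullet> y"
      using comm_scalar_prod[OF y x] .
    have "0 \<le> (x + (- t) \<cdot>\<^sub>v y) \<bullet> (B *\<^sub>v (x + (- t) \<cdot>\<^sub>v y))"
      using x y by (intro nonneg) auto
    also have "B *\<^sub>v (x + (- t) \<cdot>\<^sub>v y) = B *\<^sub>v x + (- t) \<cdot>\<^sub>v x"
      using B x y by (simp add: mult_add_distrib_mat_vec mult_mat_vec By)
    also have "(x + (- t) \<cdot>\<^sub>v y) \<bullet> (B *\<^sub>v x + (- t) \<cdot>\<^sub>v x)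
        = x \<bullet> (B *\<^sub>v x) - 2 * t * (x \<bullet> x) + t\<^sup>2 * (x \<bullet> y)"
      using x y Bx
      by (simp add: add_scalar_prod_distrib[of _ n] scalar_prod_add_distrib[of _ n] yBx yx
          power2_eq_square algebra_simps)
    finally have *: "2 * t * (x \<bullet> x) \<le> x \<bullet> (B *\<^sub>v x) + t\<^sup>2 * (x \<bullet> y)"
      by simp
    have "x \<bullet> y \<le> (\<Sum>i<n. \<Sum>j<n. \<bar>C $$ (i,j)\<bar>) * (x \<bullet> x)"
      using abs_quadratic_form_le[OF C x] by (simp add: y_def)
    also have "\<dots> \<le> K * (x \<bullet> x)"
      by (simp add: K_def distrib_right scalar_prod_self_nonneg)
    finally have "t\<^sup>2 * (x \<bullet> y) \<le> t\<^sup>2 * (K * (x \<bullet> x))"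
      by (intro mult_left_mono) auto
    \<comment> \<open>Since \<open>t * K = 1\<close>, the last term absorbs only one of the two
      copies of \<open>t * (x \<bullet> x)\<close> in \<open>*\<close>.\<close>
    also have "\<dots> = t * (x \<bullet> x)"
      using K by (simp add: t_def power2_eq_square)
    finally show ?thesis
      using * by (simp add: t_def)
  qed
  then show ?thesis
    using K by (intro exI[of _ "1 / K"]) (simp add: n_def)
qed

text \<open>The form of \<open>B' - B\<close> is at most \<open>c * (x \<bullet> x)\<close> in
  absolute value, which coercivity of \<open>B\<close> compensates.\<close>

lemma psd_mat_perturbation:
  assumes B: "B \<in> carrier_mat n n" and psd: "psd_mat B" and inv: "invertible_mat B"
  shows "\<exists>e>0. \<forall>B'\<in>carrier_mat n n. transpose_mat B' = B' \<longrightarrow>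
    (\<forall>i<n. \<forall>j<n. \<bar>B' $$ (i,j) - B $$ (i,j)\<bar> \<le> e) \<longrightarrow> psd_mat B'"
proof -
  obtain c where c: "c > 0"
    and coercive: "\<And>x. x \<in> carrier_vec n \<Longrightarrow> c * (x \<bullet> x) \<le> x \<bullet> (B *\<^sub>v x)"
    using psd_invertible_imp_coercive[OF psd inv] B by auto
  \<comment> \<open>Chosen so that \<open>n * n\<close> entries of size \<open>e\<close> sum to at
    most \<open>c\<close>; the 1 avoids division by zero when \<open>n = 0\<close>.\<close>
  define e where "e = c / (real n * real n + 1)"
  have "real n * real n + 1 > 0"
    by (simp add: add_nonneg_pos)
  then have e: "e > 0" and ec: "real n * (real n * e) \<le> c"
    using c by (auto simp: e_def field_simps)
  have "psd_mat B'"
    if B': "B' \<in> carrier_mat n n" and sym: "transpose_mat B' = B'"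
      and close: "\<forall>i<n. \<forall>j<n. \<bar>B' $$ (i,j) - B $$ (i,j)\<bar> \<le> e" for B'
  proof -
    have "0 \<le> x \<bullet> (B' *\<^sub>v x)" if x: "x \<in> carrier_vec n" for x
    proof -
      have D: "B' - B \<in> carrier_mat n n"
        using B by (rule minus_carrier_mat)
      have "(\<Sum>i<n. \<Sum>j<n. \<bar>(B' - B) $$ (i,j)\<bar>) \<le> (\<Sum>i<n. \<Sum>j<n. e)"
        using close B B' by (intro sum_mono) auto
      also have "\<dots> \<le> c"
        using ec by simp
      finally have "\<bar>x \<bullet> ((B' - B) *\<^sub>v x)\<bar> \<le> c * (x \<bullet> x)"
        using abs_quadratic_form_le[OF D x] scalar_prod_self_nonneg[of x]
        by (meson mult_right_mono order_trans)
      moreover have "x \<bullet> ((B' - B) *\<^sub>v x) = x \<bullet> (B' *\<^sub>v x) - x \<bullet> (B *\<^sub>v x)"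
        unfolding scalar_prod_mult_mat_vec[OF D x x] scalar_prod_mult_mat_vec[OF B x x]
          scalar_prod_mult_mat_vec[OF B' x x] sum_subtractf[symmetric]
        using B B' by (intro sum.cong) (auto simp: left_diff_distrib)
      ultimately show ?thesis
        using coercive[OF x] by linarith
    qed
    then show ?thesis
      using B' sym by (auto simp: psd_mat_def)
  qed
  then show ?thesis
    using e by blast
qed

section \<open>Rational rounding under linear constraints\<close>

text \<open>
  The new value at \<open>p\<close> depends on \<open>p\<close> only through \<open>b p\<close> and \<open>g p\<close>,
  which later yields a symmetric matrix.
\<close>

lemma rational_approximation_preserving_fibre_sums:
  fixes b :: "'p \<Rightarrow> real" and g :: "'p \<Rightarrow> 'k"
  assumes fin: "finite P" and e: "e > 0"
    and rat: "\<And>a. (\<Sum>p | p \<in> P \<and> g p = a. b p) \<in> \<rat>"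
  shows "\<exists>h. (\<forall>p\<in>P. h (b p) (g p) \<in> \<rat> \<and> \<bar>h (b p) (g p) - b p\<bar> \<le> e) \<and>
    (\<forall>a. (\<Sum>p | p \<in> P \<and> g p = a. h (b p) (g p)) = (\<Sum>p | p \<in> P \<and> g p = a. b p))"
proof -
  have "\<exists>q\<in>\<rat>. \<bar>q - y\<bar> \<le> e / 2" for y :: real
  proof -
    obtain q where "q \<in> \<rat>" "y < q" "q < y + e / 2"
      using Rats_dense_in_real[of y "y + e / 2"] e by auto
    then show ?thesis
      by (intro bexI[of _ q]) auto
  qed
  then obtain r where r: "\<And>y :: real. r y \<in> \<rat>" "\<And>y. \<bar>r y - y\<bar> \<le> e / 2"
    by metis
  define F where "F a = {p \<in> P. g p = a}" for a
  have finF: "finite (F a)" for a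
    using fin by (simp add: F_def)
  \<comment> \<open>The mean rounding error of the fibre, so adding it to each entry restores the
    fibre sum. On an empty fibre the division by zero gives 0.\<close>
  define d where "d a = (\<Sum>p\<in>F a. b p - r (b p)) / card (F a)" for a
  define h where "h y a = r y + d a" for y a
  \<comment> \<open>Here \<open>rat\<close> enters: the numerator is a rational fibre sum minus a
    sum of rationals.\<close>
  have dQ: "d a \<in> \<rat>" for a
  proof -
    have "(\<Sum>p\<in>F a. r (b p)) \<in> \<rat>"
      using r(1) by (intro Rats_sum)
    then show ?thesis
      using rat[of a] by (simp add: d_def sum_subtractf F_def)
  qed
  have dle: "\<bar>d a\<bar> \<le> e / 2" for a
  proof (cases "card (F a) = 0")
    case True
    then show ?thesis using e by (simp add: d_def)
  next
    case False
    have "\<bar>\<Sum>p\<in>F a. b p - r (b p)\<bar> \<le> (\<Sum>p\<in>F a. e / 2)"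
      using r(2) by (intro order_trans[OF sum_abs] sum_mono) (simp add: abs_minus_commute)
    then show ?thesis
      using False by (simp add: d_def field_simps)
  qed
  have "h (b p) (g p) \<in> \<rat> \<and> \<bar>h (b p) (g p) - b p\<bar> \<le> e" for p
    using r(1)[of "b p"] r(2)[of "b p"] dQ[of "g p"] dle[of "g p"]
    unfolding h_def by (intro conjI Rats_add) linarith+
  moreover have "(\<Sum>p\<in>F a. h (b p) (g p)) = (\<Sum>p\<in>F a. b p)" for a
  proof -
    have "(\<Sum>p\<in>F a. h (b p) (g p)) = (\<Sum>p\<in>F a. r (b p) + d a)"
      by (intro sum.cong) (auto simp: h_def F_def)
    also have "\<dots> = (\<Sum>p\<in>F a. r (b p)) + card (F a) * d a"
      by (simp add: sum.distrib)
    also have "card (F a) * d a = (\<Sum>p\<in>F a. b p - r (b p))"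
      using finF[of a] by (cases "F a = {}") (auto simp: d_def)
    finally show ?thesis
      by (simp add: sum_subtractf)
  qed
  ultimately show ?thesis
    unfolding F_def by (intro exI[of _ h]) blast
qed

section \<open>Gram matrices and coefficient equations\<close>

text \<open>Multiplying monomials adds exponents, so the coefficient at \<open>a\<close> collects
  the entries over a fibre of \<open>m i + m j\<close>. This translates polynomial identities into
  the fibre sums of the rounding step.\<close>

lemma lookup_gram_form:
  fixes A :: "real mat"
  assumes A: "A \<in> carrier_mat N N" and v: "v \<in> carrier_vec N"
    and m: "\<And>i. i < N \<Longrightarrow> v $ i = Poly_Mapping.single (m i) 1"
  shows "Poly_Mapping.lookup (v \<bullet> (map_mat mconst A *\<^sub>v v)) a
    = (\<Sum>p | p \<in> {..<N} \<times> {..<N} \<and> m (fst p) + m (snd p) = a. A $$ p)"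
proof -
  have mA: "map_mat mconst A \<in> carrier_mat N N"
    using A by simp
  have "v \<bullet> (map_mat mconst A *\<^sub>v v)
      = (\<Sum>i<N. \<Sum>j<N. Poly_Mapping.single (m i + m j) (A $$ (i,j)))"
    unfolding scalar_prod_mult_mat_vec[OF mA v v]
    using A by (intro sum.cong) (auto simp: m mult_single)
  also have "\<dots> = (\<Sum>p\<in>{..<N} \<times> {..<N}. Poly_Mapping.single (m (fst p) + m (snd p)) (A $$ p))"
    by (simp add: sum.cartesian_product split_def)
  finally show ?thesis
    by (simp add: lookup_sum lookup_single when_def sum.inter_filter)
qed

theorem theorem1p2:
  fixes n :: nat and f :: "real mpoly"
  assumes "f \<in> mpolys \<rat> n"
    and "\<exists>B. gram_matrix n f B \<and> invertible_mat B"
  shows "\<exists>B. gram_matrix n f B \<and> elements_mat B \<subseteq> \<rat>"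
proof -
  obtain B v where psd: "psd_mat B" and inv: "invertible_mat B"
    and v: "v \<in> carrier_vec (dim_row B)" and mon: "set\<^sub>v v \<subseteq> monomials n"
    and f: "f = v \<bullet> (map_mat mconst B *\<^sub>v v)"
    using assms(2) by (auto simp: gram_matrix_def)
  define N where "N = dim_row B"
  have B: "B \<in> carrier_mat N N" and sym: "transpose_mat B = B"
    using psd by (auto simp: psd_mat_def N_def)
  have v: "v \<in> carrier_vec N"
    using v by (simp add: N_def)
  have "\<exists>a. v $ i = Poly_Mapping.single a 1" if "i < N" for i
  proof -
    have "v $ i \<in> monomials n"
      using mon v that by (auto simp: vec_set_def)
    then show ?thesis
      by (auto simp: monomials_def)
  qed
  then obtain m where m: "\<And>i. i < N \<Longrightarrow> v $ i = Poly_Mapping.single (m i) 1"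
    by metis
  define P where "P = {..<N} \<times> {..<N}"
  define g where "g p = m (fst p) + m (snd p)" for p
  have coeff: "Poly_Mapping.lookup (v \<bullet> (map_mat mconst A *\<^sub>v v)) a
      = (\<Sum>p | p \<in> P \<and> g p = a. A $$ p)" if "A \<in> carrier_mat N N" for A :: "real mat" and a
    using lookup_gram_form[OF that v m] by (simp add: P_def g_def)
  have rat: "(\<Sum>p | p \<in> P \<and> g p = a. B $$ p) \<in> \<rat>" for a
  proof -
    \<comment> \<open>\<open>mpolys\<close> restricts coefficients only on the support; elsewhere
      they are 0, which is rational.\<close>
    have "Poly_Mapping.lookup f a \<in> \<rat>"
      using assms(1) by (cases "a \<in> Poly_Mapping.keys f") (auto simp: mpolys_def in_keys_iff)
    then show ?thesis
      using coeff[OF B] f by simp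
  qed
  obtain e where e: "e > 0"
    and perturb: "\<And>B'. B' \<in> carrier_mat N N \<Longrightarrow> transpose_mat B' = B' \<Longrightarrow>
      (\<forall>i<N. \<forall>j<N. \<bar>B' $$ (i,j) - B $$ (i,j)\<bar> \<le> e) \<Longrightarrow> psd_mat B'"
    using psd_mat_perturbation[OF B psd inv] by blast
  have finP: "finite P"
    by (simp add: P_def)
  obtain h where "(\<forall>p\<in>P. h (B $$ p) (g p) \<in> \<rat> \<and> \<bar>h (B $$ p) (g p) - B $$ p\<bar> \<le> e) \<and>
    (\<forall>a. (\<Sum>p | p \<in> P \<and> g p = a. h (B $$ p) (g p)) = (\<Sum>p | p \<in> P \<and> g p = a. B $$ p))"
    using rational_approximation_preserving_fibre_sums[OF finP e rat] by (rule exE)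
  then have h: "\<And>p. p \<in> P \<Longrightarrow> h (B $$ p) (g p) \<in> \<rat>"
      "\<And>p. p \<in> P \<Longrightarrow> \<bar>h (B $$ p) (g p) - B $$ p\<bar> \<le> e"
    and hsum: "\<And>a. (\<Sum>p | p \<in> P \<and> g p = a. h (B $$ p) (g p)) = (\<Sum>p | p \<in> P \<and> g p = a. B $$ p)"
    by simp_all
  define B' where "B' = mat N N (\<lambda>p. h (B $$ p) (g p))"
  have B': "B' \<in> carrier_mat N N"
    by (simp add: B'_def)
  have Bsym: "B $$ (j,i) = B $$ (i,j)" if "i < N" "j < N" for i j
    using sym B that by (metis carrier_matD index_transpose_mat(1))
  have "psd_mat B'"
  proof (rule perturb[OF B'])
    \<comment> \<open>Swapping the indices preserves both arguments of \<open>h\<close>: the entry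
      of \<open>B\<close> by symmetry, and \<open>g\<close> because exponents add
      commutatively.\<close>
    show "transpose_mat B' = B'"
      by (rule eq_matI) (auto simp: B'_def Bsym g_def add.commute)
    show "\<forall>i<N. \<forall>j<N. \<bar>B' $$ (i,j) - B $$ (i,j)\<bar> \<le> e"
      using h(2) by (auto simp: B'_def P_def)
  qed
  moreover have "f = v \<bullet> (map_mat mconst B' *\<^sub>v v)"
  proof (rule poly_mapping_eqI)
    fix a
    have "(\<Sum>p | p \<in> P \<and> g p = a. B' $$ p) = (\<Sum>p | p \<in> P \<and> g p = a. h (B $$ p) (g p))"
      by (intro sum.cong) (auto simp: B'_def P_def)
    then show "Poly_Mapping.lookup f a = Poly_Mapping.lookup (v \<bullet> (map_mat mconst B' *\<^sub>v v)) a"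
      using coeff[OF B] coeff[OF B'] hsum f by simp
  qed
  ultimately have "gram_matrix n f B'"
    using v mon B' by (auto simp: gram_matrix_def)
  moreover have "elements_mat B' \<subseteq> \<rat>"
    using h(1) by (auto simp: elements_mat_def B'_def P_def)
  ultimately show ?thesis
    by blast
qed

end
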